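(* Let $X$ be a complex Banach space and let $T\in\mathcal{B}(X)$ be a pseudo B-Fredholm operator. Then there exists $S\in\mathcal{B}(X)$ such that $T+S$ is Fredholm, $TS$ is quasi-nilpotent and $[T,S]=0$.
   Context: $\mathcal{B}(X)$ is the algebra of bounded linear operators on $X$, and $[T,S]=TS-ST$ is the commutator. $T$ is pseudo B-Fredholm if there are closed $T$-invariant subspaces $X_1,X_2$ with $X=X_1\oplus X_2$ such that $T_{|X_1}$ is Fredholm and $T_{|X_2}$ is quasi-nilpotent. *)

theory Defs
  imports "HOL-Analysis.Analysis"
begin

section \<open>Complex Banach spaces\<close>

class complex_banach = banach +
  fixes scaleC :: "complex \<Rightarrow> 'a \<Rightarrow> 'a" (infixr "*\<^sub>C" 75)
  assumes scaleC_add_right: "a *\<^sub>C (x + y) = a *\<^sub>C x + a *\<^sub>C y"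
    and scaleC_add_left: "(a + b) *\<^sub>C x = a *\<^sub>C x + b *\<^sub>C x"
    and scaleC_scaleC: "a *\<^sub>C (b *\<^sub>C x) = (a * b) *\<^sub>C x"
    and scaleR_scaleC: "scaleR r x = complex_of_real r *\<^sub>C x"
    and norm_scaleC: "norm (a *\<^sub>C x) = cmod a * norm x"

instantiation complex :: complex_banach
begin

definition scaleC_complex :: "complex \<Rightarrow> complex \<Rightarrow> complex"
  where "scaleC_complex = (*)"

instance
  by standard
    (simp_all add: scaleC_complex_def distrib_left distrib_right scaleR_conv_of_real norm_mult)

end

lemma scaleC_one: "1 *\<^sub>C x = (x :: 'a::complex_banach)"
  using scaleR_scaleC[of 1 x] by simp

global_interpretation complex_vector:
  vector_space "scaleC :: complex \<Rightarrow> 'a \<Rightarrow> 'a::complex_banach"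
  by standard (simp_all add: scaleC_add_right scaleC_add_left scaleC_scaleC scaleC_one)


section \<open>Bounded operators on a subspace\<close>

text \<open>
  An operator on a subspace \<open>M\<close> of \<open>X\<close> is represented by a function on the whole of \<open>X\<close>,
  of which only the values on \<open>M\<close> matter. Thus the restriction of \<open>T\<close> to an invariant
  subspace \<open>M\<close> is \<open>T\<close> itself, viewed as an element of \<open>bounded_ops M\<close>, and the algebra of
  bounded operators on \<open>X\<close> is \<open>bounded_ops UNIV\<close>.
\<close>

definition bounded_ops :: "'a::complex_banach set \<Rightarrow> ('a \<Rightarrow> 'a) set"
  where "bounded_ops M = {T.
    (\<forall>x\<in>M. T x \<in> M) \<and>
    (\<forall>x\<in>M. \<forall>y\<in>M. T (x + y) = T x + T y) \<and>
    (\<forall>c. \<forall>x\<in>M. T (c *\<^sub>C x) = c *\<^sub>C T x) \<and>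
    (\<exists>K. \<forall>x\<in>M. norm (T x) \<le> K * norm x)}"

lemma bounded_ops_UNIV_iff:
  "T \<in> bounded_ops UNIV \<longleftrightarrow> bounded_linear T \<and> (\<forall>c x. T (c *\<^sub>C x) = c *\<^sub>C T x)"
  by (auto simp: bounded_ops_def bounded_linear_def bounded_linear_axioms_def linear_iff
      scaleR_scaleC mult.commute)

definition commutator :: "('a::complex_banach \<Rightarrow> 'a) \<Rightarrow> ('a \<Rightarrow> 'a) \<Rightarrow> 'a \<Rightarrow> 'a"
  where "commutator T S = (\<lambda>x. T (S x) - S (T x))"


section \<open>Fredholm and quasi-nilpotent operators\<close>

text \<open>
  The kernel is finite-dimensional if it is contained in the span of a finite set; the range
  has finite codimension in \<open>M\<close> if finitely many vectors of \<open>M\<close> have cosets spanning the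
  quotient of \<open>M\<close> by the range. Closedness of the range is then automatic when \<open>M\<close> is closed.
\<close>

definition fredholm_on :: "'a::complex_banach set \<Rightarrow> ('a \<Rightarrow> 'a) \<Rightarrow> bool"
  where "fredholm_on M T \<longleftrightarrow>
    T \<in> bounded_ops M \<and>
    (\<exists>B. finite B \<and> {x\<in>M. T x = 0} \<subseteq> complex_vector.span B) \<and>
    (\<exists>B\<subseteq>M. finite B \<and> M \<subseteq> complex_vector.span (T ` M \<union> B))"

definition spectrum_on :: "'a::complex_banach set \<Rightarrow> ('a \<Rightarrow> 'a) \<Rightarrow> complex set"
  where "spectrum_on M T = {z.
    \<not> (\<exists>R\<in>bounded_ops M. \<forall>x\<in>M. R (T x - z *\<^sub>C x) = x \<and> T (R x) - z *\<^sub>C R x = x)}"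

text \<open>
  Inclusion rather than equality with \<open>{0}\<close>: the operator on the zero space has empty spectrum
  and counts as quasi-nilpotent, so that Fredholm operators are pseudo B-Fredholm.
\<close>

definition quasi_nilpotent_on :: "'a::complex_banach set \<Rightarrow> ('a \<Rightarrow> 'a) \<Rightarrow> bool"
  where "quasi_nilpotent_on M T \<longleftrightarrow> T \<in> bounded_ops M \<and> spectrum_on M T \<subseteq> {0}"

abbreviation fredholm :: "('a::complex_banach \<Rightarrow> 'a) \<Rightarrow> bool"
  where "fredholm \<equiv> fredholm_on UNIV"

abbreviation quasi_nilpotent :: "('a::complex_banach \<Rightarrow> 'a) \<Rightarrow> bool"
  where "quasi_nilpotent \<equiv> quasi_nilpotent_on UNIV"

definition pseudo_B_fredholm :: "('a::complex_banach \<Rightarrow> 'a) \<Rightarrow> bool"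
  where "pseudo_B_fredholm T \<longleftrightarrow>
    (\<exists>X1 X2.
      complex_vector.subspace X1 \<and> closed X1 \<and> T ` X1 \<subseteq> X1 \<and>
      complex_vector.subspace X2 \<and> closed X2 \<and> T ` X2 \<subseteq> X2 \<and>
      X1 \<inter> X2 = {0} \<and> (\<forall>x. \<exists>x1\<in>X1. \<exists>x2\<in>X2. x = x1 + x2) \<and>
      fredholm_on X1 T \<and> quasi_nilpotent_on X2 T)"

end

theory Submission imports Defs begin

text \<open>
  Let \<open>X\<close> be the direct sum of \<open>X\<^sub>1\<close> and \<open>X\<^sub>2\<close>, with \<open>T\<close> Fredholm on \<open>X\<^sub>1\<close> and quasi-nilpotent on
  \<open>X\<^sub>2\<close>. The projection \<open>P\<close> onto \<open>X\<^sub>2\<close> along \<open>X\<^sub>1\<close> serves as \<open>S\<close>. It commutes with \<open>T\<close> because both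
  summands are \<open>T\<close>-invariant. With respect to the decomposition, \<open>T + P\<close> is \<open>T\<close> on \<open>X\<^sub>1\<close> and \<open>T + I\<close>
  on \<open>X\<^sub>2\<close>; the latter is invertible since \<open>-1\<close> is not in the spectrum of a quasi-nilpotent operator,
  so both parts are Fredholm and hence so is their sum (\<open>fredholm_if_fredholm_on_parts\<close>). Likewise
  \<open>TP\<close> is \<open>0\<close> on \<open>X\<^sub>1\<close> and \<open>T\<close> on \<open>X\<^sub>2\<close>, and the spectrum of an operator that respects the decomposition
  is covered by the spectra of its two parts (\<open>spectrum_subset_parts\<close>), so \<open>TP\<close> is quasi-nilpotent.

  The analytic content is that \<open>P\<close> is bounded. Since \<open>X\<^sub>1\<close> and \<open>X\<^sub>2\<close> are closed, \<open>P\<close> has a closed graph,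
  and the closed graph theorem, derived here from the Baire category theorem, applies.
\<close>

section \<open>The closed graph theorem\<close>

text \<open>
  The sublevel sets of \<open>norm \<circ> f\<close> cover the space, so by Baire the closure of one of them contains
  a ball. Differences of two points of that sublevel set then approximate all small vectors, and
  scaling transports this to vectors of any size.
\<close>

lemma linear_approximation_with_bounded_image:
  fixes f :: "'a::banach \<Rightarrow> 'b::real_normed_vector"
  assumes "linear f"
  shows "\<exists>C\<ge>0. \<forall>x. \<exists>y. norm (f y) \<le> C * norm x \<and> norm (x - y) \<le> norm x / 2"
proof -
  interpret linear f by fact
  define A where "A n = closure {x. norm (f x) \<le> real n}" for n
  have "\<exists>n. interior (A n) \<noteq> {}"
  proof (rule ccontr)
    assume "\<not> (\<exists>n. interior (A n) \<noteq> {})"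
    then have "interior (\<Union>(range A)) = {}"
      using Baire_category_alt[of "euclidean :: 'a topology" "range A"]
      by (auto simp: completely_metrizable_space_euclidean A_def)
    moreover have "x \<in> \<Union>(range A)" for x
    proof -
      obtain n :: nat where "norm (f x) \<le> n"
        using real_arch_simple by blast
      then show ?thesis
        unfolding A_def using closure_subset by fastforce
    qed
    ultimately show False
      by (metis UNIV_I UNIV_eq_I empty_iff interior_UNIV)
  qed
  then obtain n a r where r: "r > 0" and ball: "ball a r \<subseteq> A n"
    by (metis ex_in_conv mem_interior)
  have small: "\<exists>y. norm (f y) \<le> 2 * n \<and> norm (x - y) < e" if "norm x < r" "e > 0" for x e
  proof -
    have "a + x \<in> A n" "a \<in> A n"
      using ball r that by (auto simp: dist_norm)
    then obtain u v where u: "norm (f u) \<le> n" "dist u (a + x) < e / 2"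
      and v: "norm (f v) \<le> n" "dist v a < e / 2"
      unfolding A_def closure_approachable using \<open>e > 0\<close> by (metis half_gt_zero mem_Collect_eq)
    have "norm (f (u - v)) \<le> 2 * n"
      using u v norm_triangle_ineq4[of "f u" "f v"] by (simp add: diff)
    moreover have "x - (u - v) = (v - a) - (u - (a + x))"
      by simp
    then have "norm (x - (u - v)) \<le> norm (v - a) + norm (u - (a + x))"
      by (metis norm_triangle_ineq4)
    then have "norm (x - (u - v)) < e"
      using u v unfolding dist_norm by linarith
    ultimately show ?thesis by blast
  qed
  \<comment> \<open>Stretched to norm \<open>r / 2\<close>, a vector is small and can be approximated to half of its norm.\<close>
  define C where "C = 4 * real n / r"
  have "\<exists>y. norm (f y) \<le> C * norm x \<and> norm (x - y) \<le> norm x / 2" for x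
  proof (cases "x = 0")
    case True
    then show ?thesis by (intro exI[of _ 0]) (simp add: zero)
  next
    case False
    define t where "t = r / (2 * norm x)"
    have t: "t > 0" and tx: "t * norm x = r / 2"
      using r False by (auto simp: t_def)
    obtain y where y: "norm (f y) \<le> 2 * n" "norm (t *\<^sub>R x - y) < r / 4"
      using small[of "t *\<^sub>R x" "r / 4"] r t tx by auto
    have image: "norm (f (y /\<^sub>R t)) \<le> C * norm x"
      using y t r False by (simp add: scale C_def t_def field_simps)
    have "x - y /\<^sub>R t = (t *\<^sub>R x - y) /\<^sub>R t"
      using t by (simp add: scaleR_diff_right)
    then have "norm (x - y /\<^sub>R t) = norm (t *\<^sub>R x - y) / t"
      using t by (simp add: divide_inverse_commute)
    moreover have "norm (t *\<^sub>R x - y) \<le> norm x / 2 * t"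
      using y(2) tx r by (simp add: mult.commute)
    then have "norm (t *\<^sub>R x - y) / t \<le> norm x / 2"
      using t by (simp add: pos_divide_le_eq)
    ultimately have "norm (x - y /\<^sub>R t) \<le> norm x / 2"
      by simp
    with image show ?thesis by blast
  qed
  moreover have "C \<ge> 0" using r by (simp add: C_def)
  ultimately show ?thesis by blast
qed

text \<open>
  Repeatedly approximating the remainder writes \<open>x\<close> as a series whose image under \<open>f\<close> converges
  absolutely, with sum of norm at most \<open>2 * C * norm x\<close>; as the graph is closed, that sum is \<open>f x\<close>.
\<close>

theorem closed_graph_bounded_linear:
  fixes f :: "'a::banach \<Rightarrow> 'b::banach"
  assumes "linear f"
    and closed_graph: "\<And>s x y. s \<longlonglongrightarrow> x \<Longrightarrow> (\<lambda>n. f (s n)) \<longlonglongrightarrow> y \<Longrightarrow> f x = y"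
  shows "bounded_linear f"
proof -
  interpret linear f by fact
  obtain C g where C: "C \<ge> 0"
    and g: "\<And>x. norm (f (g x)) \<le> C * norm x" "\<And>x. norm (x - g x) \<le> norm x / 2"
    using linear_approximation_with_bounded_image[OF assms(1)] by metis
  have "norm (f x) \<le> norm x * (2 * C)" for x
  proof -
    define r where "r k = ((\<lambda>x. x - g x) ^^ k) x" for k
    have r_Suc: "r (Suc k) = r k - g (r k)" for k by (simp add: r_def)
    have r_norm: "norm (r k) \<le> norm x * (1/2) ^ k" for k
    proof (induction k)
      case 0
      then show ?case by (simp add: r_def)
    next
      case (Suc k)
      then show ?case using g(2)[of "r k"] by (simp add: r_Suc)
    qed
    have partial: "(\<Sum>i<k. g (r i)) = x - r k" for k
      by (induction k) (simp_all add: r_Suc, simp add: r_def)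
    have "(\<lambda>k. norm x * (1/2) ^ k) \<longlonglongrightarrow> norm x * 0"
      by (intro tendsto_intros) auto
    then have "r \<longlonglongrightarrow> 0"
      using r_norm by (intro Lim_null_comparison[of r]) auto
    then have "(\<lambda>k. x - r k) \<longlonglongrightarrow> x - 0"
      by (intro tendsto_intros)
    then have lim: "(\<lambda>k. \<Sum>i<k. g (r i)) \<longlonglongrightarrow> x"
      by (simp add: partial)
    have bound: "norm (f (g (r k))) \<le> C * norm x * (1/2) ^ k" for k
      using g(1)[of "r k"] mult_left_mono[OF r_norm C, of k] by (simp add: mult.assoc)
    have geom: "(\<lambda>k. C * norm x * (1/2) ^ k) sums (C * norm x * 2)"
      using sums_mult[OF geometric_sums[of "1/2::real"], of "C * norm x"] by simp
    have "summable (\<lambda>k. norm (f (g (r k))))"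
      using bound by (intro summable_comparison_test'[OF sums_summable[OF geom]]) auto
    then have sm: "summable (\<lambda>k. f (g (r k)))"
      by (rule summable_norm_cancel)
    then have "(\<lambda>k. f (\<Sum>i<k. g (r i))) \<longlonglongrightarrow> (\<Sum>k. f (g (r k)))"
      by (simp add: sum summable_LIMSEQ)
    then have "f x = (\<Sum>k. f (g (r k)))"
      using closed_graph lim by blast
    also have "norm \<dots> \<le> (\<Sum>k. C * norm x * (1/2) ^ k)"
      using bound sums_summable[OF geom] by (rule norm_suminf_le)
    also have "\<dots> = C * norm x * 2"
      using geom by (rule sums_unique[symmetric])
    finally show ?thesis by (simp add: mult_ac)
  qed
  then show ?thesis
    by (intro bounded_linear_intro[of f "2 * C"]) (simp_all add: add scale)
qed


section \<open>Decompositions into closed subspaces\<close>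

lemma bounded_ops_bound:
  "T \<in> bounded_ops M \<Longrightarrow> \<exists>K. \<forall>x\<in>M. norm (T x) \<le> K * norm x"
  by (simp add: bounded_ops_def)

lemma complementary_component_unique:
  assumes X: "complex_vector.subspace X" and Y: "complex_vector.subspace Y" and Int: "X \<inter> Y = {0}"
    and "y \<in> Y" "y' \<in> Y" and "z - y \<in> X" "z - y' \<in> X"
  shows "y = y'"
proof -
  have "y - y' \<in> X \<inter> Y"
    using complex_vector.subspace_diff[OF X \<open>z - y' \<in> X\<close> \<open>z - y \<in> X\<close>]
      complex_vector.subspace_diff[OF Y \<open>y \<in> Y\<close> \<open>y' \<in> Y\<close>] by simp
  then show ?thesis using Int by simp
qed

locale direct_decomposition =
  fixes X Y :: "'a::complex_banach set" and P :: "'a \<Rightarrow> 'a"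
  assumes subspace_X: "complex_vector.subspace X" and subspace_Y: "complex_vector.subspace Y"
    and Int: "X \<inter> Y = {0}"
    and P_bounded: "P \<in> bounded_ops UNIV"
    and P_in: "P x \<in> Y" and coP_in: "x - P x \<in> X"
begin

lemma P_eqI: "y \<in> Y \<Longrightarrow> x - y \<in> X \<Longrightarrow> P x = y"
  using complementary_component_unique[OF subspace_X subspace_Y Int P_in _ coP_in] .

lemma P_Y: "y \<in> Y \<Longrightarrow> P y = y"
  by (rule P_eqI) (simp_all add: complex_vector.subspace_0[OF subspace_X])

lemma P_X: "x \<in> X \<Longrightarrow> P x = 0"
  by (rule P_eqI) (simp_all add: complex_vector.subspace_0[OF subspace_Y])

lemma P_linear: "P (x + y) = P x + P y" "P (x - y) = P x - P y" "P (c *\<^sub>C x) = c *\<^sub>C P x"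
  using P_bounded linear_diff[OF bounded_linear.linear, of P] linear_add[OF bounded_linear.linear, of P]
  by (auto simp: bounded_ops_UNIV_iff)

lemma P_commute:
  assumes A: "A \<in> bounded_ops UNIV" and inv: "A ` X \<subseteq> X" "A ` Y \<subseteq> Y"
  shows "P (A x) = A (P x)"
proof (rule P_eqI)
  have "A x - A (P x) = A (x - P x)"
    using A linear_diff[OF bounded_linear.linear, of A] by (simp add: bounded_ops_UNIV_iff)
  then show "A x - A (P x) \<in> X"
    using coP_in inv by auto
qed (use P_in inv in auto)

lemma direct_sum_bounded_ops:
  assumes U: "U \<in> bounded_ops X" and V: "V \<in> bounded_ops Y"
  shows "(\<lambda>x. U (x - P x) + V (P x)) \<in> bounded_ops UNIV"
proof -
  obtain K where K: "\<And>x. norm (P x) \<le> K * norm x"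
    using bounded_ops_bound[OF P_bounded] by auto
  obtain L where L: "\<And>x. x \<in> X \<Longrightarrow> norm (U x) \<le> L * norm x"
    using bounded_ops_bound[OF U] by auto
  obtain M where M: "\<And>y. y \<in> Y \<Longrightarrow> norm (V y) \<le> M * norm y"
    using bounded_ops_bound[OF V] by auto
  have bound: "norm (U (x - P x) + V (P x)) \<le> (\<bar>L\<bar> * (1 + K) + \<bar>M\<bar> * K) * norm x" for x
  proof -
    have "norm (x - P x) \<le> (1 + K) * norm x"
      using norm_triangle_ineq4[of x "P x"] K[of x] by (simp add: algebra_simps)
    then have "\<bar>L\<bar> * norm (x - P x) \<le> \<bar>L\<bar> * ((1 + K) * norm x)"
      by (rule mult_left_mono) simp
    moreover have "L * norm (x - P x) \<le> \<bar>L\<bar> * norm (x - P x)"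
      by (rule mult_right_mono) auto
    moreover have "\<bar>M\<bar> * norm (P x) \<le> \<bar>M\<bar> * (K * norm x)"
      by (rule mult_left_mono[OF K]) simp
    moreover have "M * norm (P x) \<le> \<bar>M\<bar> * norm (P x)"
      by (rule mult_right_mono) auto
    ultimately show ?thesis
      using norm_triangle_ineq[of "U (x - P x)" "V (P x)"] L[OF coP_in[of x]] M[OF P_in[of x]]
      by (simp add: algebra_simps)
  qed
  have add: "(x + y) - P (x + y) = (x - P x) + (y - P y)" for x y
    by (simp add: P_linear)
  have scale: "c *\<^sub>C x - P (c *\<^sub>C x) = c *\<^sub>C (x - P x)" for c x
    by (simp add: P_linear complex_vector.scale_right_diff_distrib)
  have "\<And>x y. U ((x + y) - P (x + y)) = U (x - P x) + U (y - P y)"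
    "\<And>c x. U (c *\<^sub>C x - P (c *\<^sub>C x)) = c *\<^sub>C U (x - P x)"
    using U coP_in unfolding add scale bounded_ops_def by blast+
  moreover have "\<And>x y. V (P (x + y)) = V (P x) + V (P y)"
    "\<And>c x. V (P (c *\<^sub>C x)) = c *\<^sub>C V (P x)"
    using V P_in unfolding P_linear bounded_ops_def by blast+
  ultimately show ?thesis
    unfolding bounded_ops_def using bound by (auto simp: scaleC_add_right)
qed

text \<open>The kernel and a complement of the range can be taken summand by summand.\<close>

lemma fredholm_if_fredholm_on_parts:
  assumes A: "A \<in> bounded_ops UNIV" and X: "fredholm_on X A" and Y: "fredholm_on Y A"
  shows "fredholm A"
proof -
  have inv: "A ` X \<subseteq> X" "A ` Y \<subseteq> Y"
    using X Y by (auto simp: fredholm_on_def bounded_ops_def)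
  have A_diff: "A (x - y) = A x - A y" for x y
    using A linear_diff[OF bounded_linear.linear, of A] by (simp add: bounded_ops_UNIV_iff)
  obtain B C where B: "finite B" "{x\<in>X. A x = 0} \<subseteq> complex_vector.span B"
    and C: "finite C" "{x\<in>Y. A x = 0} \<subseteq> complex_vector.span C"
    using X Y unfolding fredholm_on_def by blast
  obtain D E where D: "finite D" "X \<subseteq> complex_vector.span (A ` X \<union> D)"
    and E: "finite E" "Y \<subseteq> complex_vector.span (A ` Y \<union> E)"
    using X Y unfolding fredholm_on_def by blast
  have ker: "x \<in> complex_vector.span (B \<union> C)" if "A x = 0" for x
  proof -
    have "A (P x) = 0"
      using P_commute[OF A inv, of x] that P_X complex_vector.subspace_0[OF subspace_X] by simp
    moreover from this have "A (x - P x) = 0"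
      using that by (simp add: A_diff)
    ultimately have "x - P x \<in> complex_vector.span B" "P x \<in> complex_vector.span C"
      using B C P_in[of x] coP_in[of x] by auto
    then have "(x - P x) + P x \<in> complex_vector.span (B \<union> C)"
      by (intro complex_vector.span_add) (auto intro: subsetD[OF complex_vector.span_mono, rotated])
    then show ?thesis by simp
  qed
  have ran: "x \<in> complex_vector.span (range A \<union> (D \<union> E))" for x
  proof -
    have "x - P x \<in> complex_vector.span (A ` X \<union> D)" "P x \<in> complex_vector.span (A ` Y \<union> E)"
      using D E P_in[of x] coP_in[of x] by auto
    moreover have "A ` X \<union> D \<subseteq> range A \<union> (D \<union> E)" "A ` Y \<union> E \<subseteq> range A \<union> (D \<union> E)"
      by auto
    ultimately have "(x - P x) + P x \<in> complex_vector.span (range A \<union> (D \<union> E))"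
      by (intro complex_vector.span_add) (blast dest: complex_vector.span_mono)+
    then show ?thesis by simp
  qed
  show ?thesis
    unfolding fredholm_on_def
    using A B(1) C(1) D(1) E(1) ker ran
    by (intro conjI exI[of _ "B \<union> C"] exI[of _ "D \<union> E"]) auto
qed

text \<open>The direct sum of resolvents of the two parts is a resolvent of the whole.\<close>

lemma spectrum_subset_parts:
  assumes A: "A \<in> bounded_ops UNIV" and inv: "A ` X \<subseteq> X" "A ` Y \<subseteq> Y"
  shows "spectrum_on UNIV A \<subseteq> spectrum_on X A \<union> spectrum_on Y A"
proof
  fix z assume z: "z \<in> spectrum_on UNIV A"
  show "z \<in> spectrum_on X A \<union> spectrum_on Y A"
  proof (rule ccontr)
    assume "z \<notin> spectrum_on X A \<union> spectrum_on Y A"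
    then obtain U V where U: "U \<in> bounded_ops X"
      "\<And>x. x \<in> X \<Longrightarrow> U (A x - z *\<^sub>C x) = x" "\<And>x. x \<in> X \<Longrightarrow> A (U x) - z *\<^sub>C U x = x"
      and V: "V \<in> bounded_ops Y"
      "\<And>y. y \<in> Y \<Longrightarrow> V (A y - z *\<^sub>C y) = y" "\<And>y. y \<in> Y \<Longrightarrow> A (V y) - z *\<^sub>C V y = y"
      unfolding spectrum_on_def by auto
    define R where "R x = U (x - P x) + V (P x)" for x
    have A_lin: "A (x - y) = A x - A y" "A (x + y) = A x + A y" for x y
      using A linear_diff[OF bounded_linear.linear, of A] linear_add[OF bounded_linear.linear, of A]
      by (auto simp: bounded_ops_UNIV_iff)
    have "R \<in> bounded_ops UNIV"
      unfolding R_def using U(1) V(1) by (rule direct_sum_bounded_ops)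
    moreover have "R (A x - z *\<^sub>C x) = x" for x
    proof -
      have "P (A x - z *\<^sub>C x) = A (P x) - z *\<^sub>C P x"
        by (simp add: P_linear P_commute[OF A inv])
      moreover from this
      have "A x - z *\<^sub>C x - P (A x - z *\<^sub>C x) = A (x - P x) - z *\<^sub>C (x - P x)"
        by (simp add: A_lin complex_vector.scale_right_diff_distrib)
      ultimately show ?thesis
        by (simp only: R_def U(2)[OF coP_in] V(2)[OF P_in]) simp
    qed
    moreover have "A (R x) - z *\<^sub>C R x = x" for x
    proof -
      have "A (R x) - z *\<^sub>C R x = (A (U (x - P x)) - z *\<^sub>C U (x - P x)) + (A (V (P x)) - z *\<^sub>C V (P x))"
        by (simp add: R_def A_lin scaleC_add_right)
      also have "\<dots> = x"
        by (simp only: U(3)[OF coP_in] V(3)[OF P_in]) simp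
      finally show ?thesis .
    qed
    ultimately show False
      using z unfolding spectrum_on_def by blast
  qed
qed

end

text \<open>
  Boundedness of the projection rests on its closed graph: if \<open>s \<longlonglongrightarrow> x\<close> and \<open>P (s n) \<longlonglongrightarrow> y\<close>, then
  \<open>y \<in> Y\<close> and \<open>x - y \<in> X\<close> as limits in closed sets, and uniqueness of the decomposition gives
  \<open>P x = y\<close>.
\<close>

lemma closed_complements_direct_decomposition:
  assumes X: "complex_vector.subspace X" "closed X" and Y: "complex_vector.subspace Y" "closed Y"
    and Int: "X \<inter> Y = {0}" and sum: "\<forall>z. \<exists>x\<in>X. \<exists>y\<in>Y. z = x + y"
  shows "\<exists>P. direct_decomposition X Y P"
proof -
  have "\<forall>z. \<exists>y. y \<in> Y \<and> z - y \<in> X"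
    using sum by (metis add_diff_cancel_right')
  then obtain P where P: "\<And>z. P z \<in> Y" "\<And>z. z - P z \<in> X"
    by metis
  have uniq: "y \<in> Y \<Longrightarrow> z - y \<in> X \<Longrightarrow> P z = y" for y z
    using complementary_component_unique[OF X(1) Y(1) Int P(1) _ P(2)] .
  have P_add: "P (x + y) = P x + P y" for x y
  proof (rule uniq)
    show "x + y - (P x + P y) \<in> X"
      using complex_vector.subspace_add[OF X(1) P(2)[of x] P(2)[of y]] by (simp add: algebra_simps)
  qed (simp add: P Y complex_vector.subspace_add)
  have P_scale: "P (c *\<^sub>C x) = c *\<^sub>C P x" for c x
  proof (rule uniq)
    show "c *\<^sub>C x - c *\<^sub>C P x \<in> X"
      using complex_vector.subspace_scale[OF X(1) P(2)[of x], of c]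
      by (simp add: complex_vector.scale_right_diff_distrib)
  qed (simp add: P Y complex_vector.subspace_scale)
  have "bounded_linear P"
  proof (rule closed_graph_bounded_linear)
    show "linear P"
      by (rule linearI) (simp_all add: P_add P_scale scaleR_scaleC)
    fix s x y assume lim: "s \<longlonglongrightarrow> x" "(\<lambda>n. P (s n)) \<longlonglongrightarrow> y"
    show "P x = y"
    proof (rule uniq)
      show "y \<in> Y"
        using Y(2) P(1) lim(2) by (rule closed_sequentially)
      show "x - y \<in> X"
        using X(2) P(2) tendsto_diff[OF lim] by (rule closed_sequentially)
    qed
  qed
  then have "P \<in> bounded_ops UNIV"
    by (simp add: bounded_ops_UNIV_iff P_scale)
  then show ?thesis
    using X(1) Y(1) Int P by (intro exI[of _ P]) unfold_locales
qed


section \<open>Perturbing the quasi-nilpotent part\<close>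

lemma bounded_ops_cong:
  assumes "complex_vector.subspace M" and "\<And>x. x \<in> M \<Longrightarrow> A x = B x"
  shows "A \<in> bounded_ops M \<longleftrightarrow> B \<in> bounded_ops M"
  using assms complex_vector.subspace_add[OF assms(1)] complex_vector.subspace_scale[OF assms(1)]
  by (simp add: bounded_ops_def)

lemma fredholm_on_cong:
  assumes "complex_vector.subspace M" and eq: "\<And>x. x \<in> M \<Longrightarrow> A x = B x"
  shows "fredholm_on M A \<longleftrightarrow> fredholm_on M B"
proof -
  have "{x\<in>M. A x = 0} = {x\<in>M. B x = 0}" "A ` M = B ` M"
    using eq by auto
  then show ?thesis
    unfolding fredholm_on_def using bounded_ops_cong[OF assms] by simp
qed

lemma spectrum_on_cong:
  assumes "\<And>x. x \<in> M \<Longrightarrow> A x = B x"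
  shows "spectrum_on M A = spectrum_on M B"
proof -
  have "(\<forall>x\<in>M. R (A x - z *\<^sub>C x) = x \<and> A (R x) - z *\<^sub>C R x = x) \<longleftrightarrow>
    (\<forall>x\<in>M. R (B x - z *\<^sub>C x) = x \<and> B (R x) - z *\<^sub>C R x = x)" if "R \<in> bounded_ops M" for R z
    using that assms by (auto simp: bounded_ops_def)
  then show ?thesis
    unfolding spectrum_on_def by blast
qed

lemma scale_bounded_ops:
  assumes "complex_vector.subspace M"
  shows "(\<lambda>x. c *\<^sub>C x) \<in> bounded_ops M"
  using complex_vector.subspace_scale[OF assms]
  by (auto simp: bounded_ops_def scaleC_add_right scaleC_scaleC mult.commute norm_scaleC
      intro: exI[of _ "cmod c"])

lemma spectrum_on_zero:
  assumes "complex_vector.subspace M"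
  shows "spectrum_on M (\<lambda>_. 0) \<subseteq> {0}"
proof -
  have "z \<notin> spectrum_on M (\<lambda>_. 0)" if "z \<noteq> 0" for z
    unfolding spectrum_on_def mem_Collect_eq not_not
    using that
    by (intro bexI[OF _ scale_bounded_ops[OF assms, of "- inverse z"]])
      (simp add: scaleC_scaleC scaleC_one)
  then show ?thesis by blast
qed

text \<open>Outside the spectrum the shifted operator is bijective on \<open>M\<close>, so its kernel is zero and its range is \<open>M\<close>.\<close>

lemma fredholm_on_if_not_in_spectrum:
  assumes M: "complex_vector.subspace M" and A: "A \<in> bounded_ops M" and z: "z \<notin> spectrum_on M A"
  shows "fredholm_on M (\<lambda>x. A x - z *\<^sub>C x)"
proof -
  obtain R where R: "R \<in> bounded_ops M" "\<And>x. x \<in> M \<Longrightarrow> R (A x - z *\<^sub>C x) = x"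
    "\<And>x. x \<in> M \<Longrightarrow> A (R x) - z *\<^sub>C R x = x"
    using z unfolding spectrum_on_def by auto
  obtain K where K: "\<And>x. x \<in> M \<Longrightarrow> norm (A x) \<le> K * norm x"
    using A unfolding bounded_ops_def by blast
  have R_M: "R x \<in> M" if "x \<in> M" for x
    using R(1) that by (simp add: bounded_ops_def)
  have "norm (A x - z *\<^sub>C x) \<le> (K + cmod z) * norm x" if "x \<in> M" for x
    using norm_triangle_ineq4[of "A x" "z *\<^sub>C x"] K[OF that] by (simp add: norm_scaleC algebra_simps)
  then have "\<exists>K. \<forall>x\<in>M. norm (A x - z *\<^sub>C x) \<le> K * norm x"
    by blast
  moreover have "A x - z *\<^sub>C x \<in> M" if "x \<in> M" for x
    using A complex_vector.subspace_diff[OF M] complex_vector.subspace_scale[OF M] that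
    by (simp add: bounded_ops_def)
  moreover have "A (x + y) - z *\<^sub>C (x + y) = (A x - z *\<^sub>C x) + (A y - z *\<^sub>C y)"
    if "x \<in> M" "y \<in> M" for x y
    using A that by (simp add: bounded_ops_def scaleC_add_right)
  moreover have "A (c *\<^sub>C x) - z *\<^sub>C (c *\<^sub>C x) = c *\<^sub>C (A x - z *\<^sub>C x)" if "x \<in> M" for c x
  proof -
    have "A (c *\<^sub>C x) = c *\<^sub>C A x"
      using A that by (simp add: bounded_ops_def)
    then show ?thesis
      by (simp add: complex_vector.scale_right_diff_distrib mult.commute[of z c])
  qed
  ultimately have bdd: "(\<lambda>x. A x - z *\<^sub>C x) \<in> bounded_ops M"
    unfolding bounded_ops_def by blast
  have zero_M: "0 \<in> M"
    by (rule complex_vector.subspace_0[OF M])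
  have "A (0 *\<^sub>C 0) = 0 *\<^sub>C A 0"
    using A zero_M unfolding bounded_ops_def by blast
  then have "R 0 = 0"
    using R(2)[OF zero_M] by simp
  then have "x = 0" if "x \<in> M" "A x - z *\<^sub>C x = 0" for x
    using R(2)[OF that(1)] that(2) by simp
  then have "{x\<in>M. A x - z *\<^sub>C x = 0} \<subseteq> complex_vector.span {}"
    by auto
  moreover have "x \<in> (\<lambda>x. A x - z *\<^sub>C x) ` M" if "x \<in> M" for x
    using R(3)[OF that] R_M[OF that] by (intro image_eqI[of _ _ "R x"]) simp_all
  then have "M \<subseteq> complex_vector.span ((\<lambda>x. A x - z *\<^sub>C x) ` M \<union> {})"
    by (auto intro: complex_vector.span_base)
  ultimately show ?thesis
    unfolding fredholm_on_def using bdd finite.emptyI empty_subsetI by blast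
qed

theorem proposition4p1:
  fixes T :: "'a::complex_banach \<Rightarrow> 'a"
  assumes "T \<in> bounded_ops UNIV" and "pseudo_B_fredholm T"
  shows "\<exists>S\<in>bounded_ops UNIV.
    fredholm (\<lambda>x. T x + S x) \<and> quasi_nilpotent (T \<circ> S) \<and> commutator T S = (\<lambda>_. 0)"
proof -
  obtain X Y where XY: "complex_vector.subspace X" "closed X" "T ` X \<subseteq> X"
      "complex_vector.subspace Y" "closed Y" "T ` Y \<subseteq> Y"
      "X \<inter> Y = {0}" "\<forall>z. \<exists>x\<in>X. \<exists>y\<in>Y. z = x + y"
    and fredholm_X: "fredholm_on X T" and qn: "quasi_nilpotent_on Y T"
    using assms(2) unfolding pseudo_B_fredholm_def by metis
  obtain P where "direct_decomposition X Y P"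
    using closed_complements_direct_decomposition XY by metis
  then interpret direct_decomposition X Y P .
  have T: "bounded_linear T" "\<And>c x. T (c *\<^sub>C x) = c *\<^sub>C T x"
    and P: "bounded_linear P" "\<And>c x. P (c *\<^sub>C x) = c *\<^sub>C P x"
    using assms(1) P_bounded by (auto simp: bounded_ops_UNIV_iff)
  have T0: "T 0 = 0"
    using T(1) by (simp add: linear_0 bounded_linear.linear)
  have "fredholm (\<lambda>x. T x + P x)"
  proof (rule fredholm_if_fredholm_on_parts)
    show "(\<lambda>x. T x + P x) \<in> bounded_ops UNIV"
      using T P by (simp add: bounded_ops_UNIV_iff bounded_linear_add scaleC_add_right)
    show "fredholm_on X (\<lambda>x. T x + P x)"
      using fredholm_X fredholm_on_cong[OF subspace_X, of T "\<lambda>x. T x + P x"] by (simp add: P_X)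
    have "fredholm_on Y (\<lambda>x. T x - (- 1) *\<^sub>C x)"
      using qn by (intro fredholm_on_if_not_in_spectrum subspace_Y) (auto simp: quasi_nilpotent_on_def)
    then show "fredholm_on Y (\<lambda>x. T x + P x)"
      using fredholm_on_cong[OF subspace_Y, of "\<lambda>x. T x - (- 1) *\<^sub>C x" "\<lambda>x. T x + P x"]
      by (simp add: P_Y scaleC_one)
  qed
  moreover have "quasi_nilpotent (T \<circ> P)"
  proof -
    have TP: "T \<circ> P \<in> bounded_ops UNIV"
      using T P by (simp add: bounded_ops_UNIV_iff bounded_linear_compose o_def)
    have "spectrum_on UNIV (T \<circ> P) \<subseteq> spectrum_on X (T \<circ> P) \<union> spectrum_on Y (T \<circ> P)"
      using XY P_X P_Y T0 complex_vector.subspace_0[OF subspace_X]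
      by (intro spectrum_subset_parts TP) auto
    also have "spectrum_on X (T \<circ> P) = spectrum_on X (\<lambda>_. 0)"
      by (rule spectrum_on_cong) (simp add: P_X T0)
    also have "spectrum_on Y (T \<circ> P) = spectrum_on Y T"
      by (rule spectrum_on_cong) (simp add: P_Y)
    also have "spectrum_on X (\<lambda>_. 0) \<union> spectrum_on Y T \<subseteq> {0}"
      using spectrum_on_zero[OF subspace_X] qn by (simp add: quasi_nilpotent_on_def)
    finally show ?thesis
      using TP unfolding quasi_nilpotent_on_def by (rule conjI[rotated])
  qed
  moreover have "commutator T P = (\<lambda>_. 0)"
    using P_commute[OF assms(1) XY(3,6)] by (simp add: commutator_def)
  ultimately show ?thesis
    using P_bounded by blast
qed

end
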